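(* Let $\psi:\mathbb{R}^d\to[0,\infty)$ be a bounded measurable function supported in the unit ball of $\mathbb{R}^d$, let $a:\mathbb{R}^d\to\mathbb{R}^d$ be a diffeomorphism homogeneous of degree one, that is, $a(Rx)=Ra(x)$ for all $R>0$ and $x\in\mathbb{R}^d$, and let $K(x,y)=\psi(y-a(x))+\psi(x-a(y))$ for $x,y\in\mathbb{R}^d$. Then $$\lambda_1(\mathbb{R}^d)\le 2\left(\int_{\mathbb{R}^d}\psi(x)\,dx\right)\inf_{\|\phi\|_{L^2(B_1)}=1}\int_{\mathbb{R}^d}\big(\phi(x)-\phi(a(x))\big)^2\,dx,$$ where the infimum is taken over all functions $\phi\in L^2(\mathbb{R}^d)$ supported in the unit ball $B_1$ of $\mathbb{R}^d$ with $\|\phi\|_{L^2(B_1)}=1$.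
   Context: The first eigenvalue in the whole space associated with the kernel $K$ is $$\lambda_1(\mathbb{R}^d)=\inf_{u\in L^2(\mathbb{R}^d),\,u\neq 0}\frac{\int_{\mathbb{R}^d}\int_{\mathbb{R}^d}K(x,y)(u(x)-u(y))^2\,dx\,dy}{\int_{\mathbb{R}^d}u^2(x)\,dx}.$$ Functions are real valued. $B_1$ is the unit ball centered at the origin. *)

theory Defs
  imports "HOL-Analysis.Analysis"
begin

text \<open>
  Integrals of nonnegative functions are Lebesgue integrals with values in [0,\<infinity>], so no integral
  below gets a default value for lack of integrability.  "Measurable" means Lebesgue measurable.
\<close>

definition L2 :: "('a::euclidean_space \<Rightarrow> real) set" where
  "L2 = {u. u \<in> borel_measurable lebesgue \<and> integrable lebesgue (\<lambda>x. (u x)\<^sup>2)}"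

definition L2_norm_on :: "'a::euclidean_space set \<Rightarrow> ('a \<Rightarrow> real) \<Rightarrow> real" where
  "L2_norm_on S u = sqrt (LINT x:S|lebesgue. (u x)\<^sup>2)"

text \<open>
  Elements of \<^const>\<open>L2\<close> are functions rather than classes, so \<open>u \<noteq> 0\<close> is read as "not almost
  everywhere zero".  The kernel \<open>K\<close> is meant to be nonnegative (\<^const>\<open>ennreal\<close> truncates
  negative values).
\<close>

definition lambda1 :: "('a::euclidean_space \<Rightarrow> 'a \<Rightarrow> real) \<Rightarrow> ennreal" where
  "lambda1 K =
     (INF u \<in> {u \<in> L2. \<not> (AE x in lebesgue. u x = 0)}.
        (\<integral>\<^sup>+y. (\<integral>\<^sup>+x. ennreal (K x y * (u x - u y)\<^sup>2) \<partial>lebesgue) \<partial>lebesgue)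
          / (\<integral>\<^sup>+x. ennreal ((u x)\<^sup>2) \<partial>lebesgue))"

definition C1_map :: "('a::real_normed_vector \<Rightarrow> 'b::real_normed_vector) \<Rightarrow> bool" where
  "C1_map f \<longleftrightarrow>
     (\<exists>f' :: 'a \<Rightarrow> 'a \<Rightarrow>\<^sub>L 'b.
        (\<forall>x. (f has_derivative blinfun_apply (f' x)) (at x)) \<and> continuous_on UNIV f')"

definition diffeomorphism :: "('a::real_normed_vector \<Rightarrow> 'b::real_normed_vector) \<Rightarrow> bool" where
  "diffeomorphism f \<longleftrightarrow> bij f \<and> C1_map f \<and> C1_map (inv f)"

text \<open>
  The unit ball is taken closed; as the unit sphere is a null set, this does not affect
  the class of admissible functions, where the support condition holds almost everywhere.
\<close>

definition admissible :: "('a::euclidean_space \<Rightarrow> real) set" where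
  "admissible = {\<phi> \<in> L2. (AE x in lebesgue. x \<notin> cball 0 1 \<longrightarrow> \<phi> x = 0) \<and>
                          L2_norm_on (cball 0 1) \<phi> = 1}"

end

theory Submission
  imports Defs
begin

text \<open>
  A homogeneous map of degree one that is differentiable at the origin coincides with its derivative
  there, so \<open>a\<close> is an invertible linear map; it preserves null sets and multiplies integrals by a
  constant.  By Tonelli's theorem the energy of \<open>u\<close> is \<open>2 \<integral> \<psi>(z) \<integral> (u(x) - u(a x + z))\<^sup>2 dx dz\<close>.
  For \<open>u(x) = \<phi>(s x)\<close> the inner integral rescales to \<open>\<integral> (\<phi>(x) - \<phi>(a x + s z))\<^sup>2 dx\<close>, and the scaling factor
  cancels against that of the denominator.  Since \<open>\<psi>\<close> lives on the unit ball, continuity of translations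
  in \<open>L2\<close> makes these integrals converge to \<open>\<integral> (\<phi>(x) - \<phi>(a x))\<^sup>2 dx\<close> uniformly in \<open>z\<close> as \<open>s \<rightarrow> 0\<close>.
\<close>

subsection \<open>Linear maps and Lebesgue measure\<close>

text \<open>On the ray through \<open>x\<close>, homogeneity makes \<open>a (t *\<^sub>R x)\<close>
  divided by \<open>t\<close> constantly \<open>a x\<close>, while differentiability at 0 forces
  this quotient to tend to \<open>D x\<close>. So \<open>a\<close> inherits linearity from its
  derivative.\<close>

lemma has_derivative_homogeneous_imp_eq:
  fixes a :: "'a::real_normed_vector \<Rightarrow> 'b::real_normed_vector"
  assumes deriv: "(a has_derivative D) (at 0)"
    and hom: "\<And>R x. R > 0 \<Longrightarrow> a (R *\<^sub>R x) = R *\<^sub>R a x"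
  shows "a = D"
proof
  fix x
  \<comment> \<open>The value \<open>R = 0\<close> is excluded in \<open>hom\<close>, but
    \<open>R = 2\<close> gives \<open>a 0 = a 0 + a 0\<close>.\<close>
  have a0: "a 0 = 0"
    using hom[of 2 0] by (simp add: scaleR_2)
  interpret D: bounded_linear D
    using deriv by (rule has_derivative_bounded_linear)
  have le: "norm (a x - D x) \<le> e * norm x" if "e > 0" for e
  proof -
    obtain d where "d > 0" and d: "\<And>y. norm y < d \<Longrightarrow> norm (a y - D y) \<le> e * norm y"
      using deriv \<open>e > 0\<close> unfolding has_derivative_at_alt by (auto simp: a0)
    \<comment> \<open>This brings \<open>t *\<^sub>R x\<close> within \<open>d / 2\<close> of the
      origin; adding 1 in the denominator covers \<open>x = 0\<close>.\<close>
    define t where "t = d / (2 * (norm x + 1))"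
    have nx: "norm x + 1 > 0"
      by (simp add: add_nonneg_pos)
    have t: "t > 0"
      using \<open>d > 0\<close> nx by (simp add: t_def)
    have "t * norm x \<le> t * (norm x + 1)"
      using t by (simp add: mult_left_mono)
    also have "\<dots> = d / 2"
      using nx by (simp add: t_def field_simps)
    also have "\<dots> < d"
      using \<open>d > 0\<close> by simp
    finally have "norm (t *\<^sub>R x) < d"
      using t by simp
    from d[OF this] have "t * norm (a x - D x) \<le> t * (e * norm x)"
      using t by (simp add: hom D.scaleR flip: scaleR_diff_right)
    then show ?thesis
      using t by simp
  qed
  have "norm (a x - D x) \<le> 0"
  proof (rule field_le_epsilon)
    fix e :: real assume "e > 0"
    have nx: "norm x + 1 > 0"
      by (simp add: add_nonneg_pos)
    have "e / (norm x + 1) * norm x \<le> e / (norm x + 1) * (norm x + 1)"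
      using \<open>e > 0\<close> nx by (intro mult_left_mono) auto
    then show "norm (a x - D x) \<le> 0 + e"
      using le[of "e / (norm x + 1)"] nx \<open>e > 0\<close> by simp
  qed
  then show "a x = D x"
    by simp
qed

lemma nn_integral_lborel_translate:
  fixes g :: "'a::euclidean_space \<Rightarrow> ennreal"
  assumes [measurable]: "g \<in> borel_measurable borel"
  shows "(\<integral>\<^sup>+x. g (x + c) \<partial>lborel) = (\<integral>\<^sup>+x. g x \<partial>lborel)"
proof -
  have "(\<integral>\<^sup>+x. g x \<partial>lborel) = (\<integral>\<^sup>+x. g x \<partial>distr lborel borel ((+) c))"
    by (simp add: lborel_distr_plus)
  also have "\<dots> = (\<integral>\<^sup>+x. g (x + c) \<partial>lborel)"
    by (simp add: nn_integral_distr add.commute)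
  finally show ?thesis ..
qed

lemma nn_integral_lborel_reflect:
  fixes g :: "'a::euclidean_space \<Rightarrow> ennreal"
  assumes [measurable]: "g \<in> borel_measurable borel"
  shows "(\<integral>\<^sup>+x. g (c - x) \<partial>lborel) = (\<integral>\<^sup>+x. g x \<partial>lborel)"
proof -
  have "(lborel :: 'a measure) = distr lborel borel (\<lambda>x. c - x)"
    using lborel_affine[of "-1" c] by (simp add: density_1)
  then have "(\<integral>\<^sup>+x. g x \<partial>lborel) = (\<integral>\<^sup>+x. g x \<partial>distr lborel borel (\<lambda>x. c - x))"
    by simp
  also have "\<dots> = (\<integral>\<^sup>+x. g (c - x) \<partial>lborel)"
    by (simp add: nn_integral_distr)
  finally show ?thesis ..
qed

lemma linear_borel_measurable:
  fixes a :: "'a::euclidean_space \<Rightarrow> 'b::euclidean_space"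
  shows "linear a \<Longrightarrow> a \<in> borel_measurable borel"
  by (intro borel_measurable_continuous_onI linear_continuous_on linear_conv_bounded_linear[THEN iffD1])

text \<open>Both sides equal the double integral of \<open>g (a x) * f (a x + y)\<close>.\<close>

lemma nn_integral_linear_swap:
  fixes a :: "'a::euclidean_space \<Rightarrow> 'a" and f g :: "'a \<Rightarrow> ennreal"
  assumes a: "linear a" "bij a"
    and [measurable]: "f \<in> borel_measurable borel" "g \<in> borel_measurable borel"
  shows "(\<integral>\<^sup>+x. g (a x) \<partial>lborel) * (\<integral>\<^sup>+x. f x \<partial>lborel)
       = (\<integral>\<^sup>+x. f (a x) \<partial>lborel) * (\<integral>\<^sup>+x. g x \<partial>lborel)"
proof -
  note [measurable] = linear_borel_measurable[OF a(1)]
  have inv: "a (inv a y) = y" for y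
    using a(2) by (simp add: bij_is_surj surj_f_inv_f)
  have "(\<integral>\<^sup>+x. g (a x) \<partial>lborel) * (\<integral>\<^sup>+x. f x \<partial>lborel)
      = (\<integral>\<^sup>+x. g (a x) * (\<integral>\<^sup>+y. f (y + a x) \<partial>lborel) \<partial>lborel)"
    by (simp add: nn_integral_lborel_translate nn_integral_multc)
  also have "\<dots> = (\<integral>\<^sup>+x. (\<integral>\<^sup>+y. g (a x) * f (y + a x) \<partial>lborel) \<partial>lborel)"
    by (simp add: nn_integral_cmult)
  also have "\<dots> = (\<integral>\<^sup>+y. (\<integral>\<^sup>+x. g (a x) * f (y + a x) \<partial>lborel) \<partial>lborel)"
    by (rule lborel_pair.Fubini'[symmetric]) measurable
  also have "\<dots> = (\<integral>\<^sup>+y. (\<integral>\<^sup>+x. g (a x - y) * f (a x) \<partial>lborel) \<partial>lborel)"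
  proof (rule nn_integral_cong)
    fix y
    show "(\<integral>\<^sup>+x. g (a x) * f (y + a x) \<partial>lborel) = (\<integral>\<^sup>+x. g (a x - y) * f (a x) \<partial>lborel)"
      \<comment> \<open>Shifting \<open>x\<close> by \<open>inv a y\<close> shifts
        \<open>a x\<close> by \<open>y\<close>; this is where additivity and surjectivity of
        \<open>a\<close> enter.\<close>
      using nn_integral_lborel_translate[of "\<lambda>x. g (a x - y) * f (a x)" "inv a y"]
      by (simp add: linear_add[OF a(1)] inv add.commute)
  qed
  also have "\<dots> = (\<integral>\<^sup>+x. (\<integral>\<^sup>+y. g (a x - y) * f (a x) \<partial>lborel) \<partial>lborel)"
    by (rule lborel_pair.Fubini') measurable
  also have "\<dots> = (\<integral>\<^sup>+x. g x \<partial>lborel) * (\<integral>\<^sup>+x. f (a x) \<partial>lborel)"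
    by (simp add: nn_integral_multc nn_integral_cmult nn_integral_lborel_reflect)
  also have "\<dots> = (\<integral>\<^sup>+x. f (a x) \<partial>lborel) * (\<integral>\<^sup>+x. g x \<partial>lborel)"
    by (rule mult.commute)
  finally show ?thesis .
qed

lemma emeasure_lborel_open_pos:
  fixes S :: "'a::euclidean_space set"
  assumes "open S" "x \<in> S"
  shows "emeasure lborel S > 0"
  using open_not_negligible[of S] assms
  by (auto simp: negligible_iff_null_sets null_sets_def zero_less_iff_neq_zero)

lemma nn_integral_linear:
  fixes a :: "'a::euclidean_space \<Rightarrow> 'a"
  assumes a: "linear a" "bij a"
  obtains c :: real where "c > 0"
    "\<And>g. g \<in> borel_measurable borel \<Longrightarrow>
       (\<integral>\<^sup>+x. g (a x) \<partial>lborel) = ennreal c * (\<integral>\<^sup>+x. g x \<partial>lborel)"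
proof -
  note [measurable] = linear_borel_measurable[OF a(1)]
  let ?B = "ball 0 1 :: 'a set"
  have lin_inv: "linear (inv a)"
    using a by (simp add: bij_is_inj inj_linear_imp_inv_linear)
  have im: "a -` ?B = inv a ` ?B"
    using a(2) by (simp add: bij_vimage_eq_inv_image)
  have "open (a -` ?B)"
    by (intro open_vimage linear_continuous_on linear_conv_bounded_linear[THEN iffD1] a) auto
  moreover have "0 \<in> a -` ?B"
    by (simp add: linear_0[OF a(1)])
  ultimately have "emeasure lborel (a -` ?B) > 0"
    by (metis emeasure_lborel_open_pos)
  have "bounded (a -` ?B)"
    unfolding im by (intro bounded_linear_image linear_conv_bounded_linear[THEN iffD1] lin_inv) auto
  then have "emeasure lborel (a -` ?B) < \<infinity>"
    by (rule emeasure_bounded_finite)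
  then obtain p where p: "emeasure lborel (a -` ?B) = ennreal p" "p \<ge> 0"
    by (cases "emeasure lborel (a -` ?B)") auto
  have "emeasure lborel ?B < \<infinity>"
    by (rule emeasure_bounded_finite) auto
  then obtain q where q: "emeasure lborel ?B = ennreal q" "q \<ge> 0"
    by (cases "emeasure lborel ?B") auto
  have "p > 0"
    using \<open>emeasure lborel (a -` ?B) > 0\<close> p by simp
  have "emeasure lborel ?B > 0"
    by (metis emeasure_lborel_open_pos open_ball centre_in_ball zero_less_one)
  then have "q > 0"
    using q by simp
  have "(\<integral>\<^sup>+x. indicator ?B (a x) \<partial>lborel) = (\<integral>\<^sup>+x. indicator (a -` ?B) x \<partial>lborel)"
    by (intro nn_integral_cong) (auto simp: indicator_def)
  also have "\<dots> = ennreal p"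
    using p \<open>open (a -` ?B)\<close> by simp
  finally have eq: "(\<integral>\<^sup>+x. g (a x) \<partial>lborel) * ennreal q = ennreal p * (\<integral>\<^sup>+x. g x \<partial>lborel)"
    if "g \<in> borel_measurable borel" for g
    using nn_integral_linear_swap[OF a borel_measurable_indicator that, of ?B] q by simp
  show ?thesis
  proof
    show "p / q > 0"
      using \<open>p > 0\<close> \<open>q > 0\<close> by simp
    fix g :: "'a \<Rightarrow> ennreal" assume "g \<in> borel_measurable borel"
    have "(\<integral>\<^sup>+x. g (a x) \<partial>lborel) = (\<integral>\<^sup>+x. g (a x) \<partial>lborel) * (ennreal q * ennreal (1 / q))"
      using \<open>q > 0\<close> by (simp flip: ennreal_mult)
    also have "\<dots> = ennreal p * (\<integral>\<^sup>+x. g x \<partial>lborel) * ennreal (1 / q)"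
      by (simp add: eq[OF \<open>g \<in> _\<close>] flip: mult.assoc)
    also have "\<dots> = ennreal (p / q) * (\<integral>\<^sup>+x. g x \<partial>lborel)"
      using \<open>p > 0\<close> \<open>q > 0\<close> by (simp add: divide_inverse ennreal_mult mult_ac)
    finally show "(\<integral>\<^sup>+x. g (a x) \<partial>lborel) = ennreal (p / q) * (\<integral>\<^sup>+x. g x \<partial>lborel)" .
  qed
qed

subsection \<open>Continuity of translations\<close>

text \<open>Regularity squeezes \<open>A\<close> between a compact \<open>C\<close> and an open
  \<open>U\<close> whose difference is small. For \<open>h\<close> shorter than the gap between
  \<open>C\<close> and the complement of \<open>U\<close>, the indicator can change between
  \<open>x\<close> and \<open>x + h\<close> only if one of these two points lies in
  \<open>U - C\<close>.\<close>

lemma tendsto_translate_indicator: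
  fixes A :: "'a::euclidean_space set"
  assumes A: "A \<in> sets borel" "emeasure lborel A < \<infinity>"
  shows "((\<lambda>h. \<integral>\<^sup>+x. ennreal \<bar>indicator A (x + h) - indicator A x\<bar> \<partial>lborel) \<longlongrightarrow> 0) (nhds 0)"
proof (rule tendsto_zero_ennreal)
  fix e :: real assume "e > 0"
  note [measurable] = A(1)
  \<comment> \<open>Inner regularity is applied to a finite measure, hence the restriction of
    Lebesgue measure to \<open>A\<close>.\<close>
  let ?M = "density lborel (indicator A)"
  have em: "emeasure ?M B = emeasure lborel (A \<inter> B)" if "B \<in> sets borel" for B
    using that by (simp add: emeasure_density flip: indicator_inter_arith)
  \<comment> \<open>With \<open>e / 5\<close> for each of the two approximations,
    \<open>U - C\<close> has measure at most \<open>2 * e / 5\<close>; it is counted twice below,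
    giving \<open>4 * e / 5 < e\<close>.\<close>
  obtain C where C: "C \<subseteq> A" "compact C" and "emeasure lborel (A - C) < ennreal (e / 5)"
  \<comment> \<open>The null case is separate because \<open>ennreal\<close> truncates at 0: the
    strict bound \<open>ennreal (m - e / 5) < ennreal m\<close> needs \<open>m > 0\<close>.\<close>
  proof (cases "emeasure lborel A = 0")
    case True
    then show ?thesis
      using that[of "{}"] \<open>e > 0\<close> by simp
  next
    case False
    obtain m where m: "emeasure lborel A = ennreal m" "m > 0"
      using False A(2) by (cases "emeasure lborel A") (auto simp: less_le)
    have "emeasure ?M A = (SUP K\<in>{K. K \<subseteq> A \<and> compact K}. emeasure ?M K)"
      using A by (intro inner_regular) (auto simp: em)
    moreover have "ennreal (m - e / 5) < emeasure ?M A"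
      using \<open>e > 0\<close> m by (simp add: em ennreal_less_iff ennreal_lessI)
    ultimately obtain K where K: "K \<subseteq> A" "compact K" "ennreal (m - e / 5) < emeasure ?M K"
      by (auto simp: less_SUP_iff)
    have [measurable]: "K \<in> sets borel"
      using K(2) by (simp add: compact_imp_closed)
    have Kfin: "emeasure lborel K < \<infinity>"
      using K(2) compact_imp_bounded emeasure_bounded_finite by blast
    then obtain k where k: "emeasure lborel K = ennreal k" "k \<ge> 0"
      by (cases "emeasure lborel K") auto
    have "ennreal (m - e / 5) < ennreal k"
      using K k by (simp add: em Int_absorb1)
    then have "m - e / 5 < k"
      by (metis ennreal_leI linorder_not_le)
    have "emeasure lborel (A - K) = ennreal m - ennreal k"
      using K Kfin by (simp add: emeasure_Diff k m)
    also have "\<dots> < ennreal (e / 5)"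
      using \<open>m - e / 5 < k\<close> k \<open>e > 0\<close> by (simp add: ennreal_minus ennreal_lessI)
    finally show ?thesis
      using K that by blast
  qed
  obtain U where U: "open U" "A \<subseteq> U" "emeasure lborel (U - A) < ennreal (e / 5)"
    using outer_regular_lborel[OF A(1), of "e / 5"] \<open>e > 0\<close> by auto
  obtain d where d: "d > 0" "\<And>x y. x \<in> C \<Longrightarrow> y \<notin> U \<Longrightarrow> d \<le> dist x y"
  proof -
    have "closed (- U)" "C \<inter> - U = {}"
      using C U by auto
    from separate_compact_closed[OF C(2) this] show ?thesis
      using that by (auto simp: Ball_def)
  qed
  have [measurable]: "C \<in> sets borel" "U \<in> sets borel"
    using C(2) U(1) by (auto simp: compact_imp_closed)
  have UC: "emeasure lborel (U - C) \<le> ennreal (2 * e / 5)"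
  proof -
    have "U - C = (U - A) \<union> (A - C)"
      using C U by auto
    then have "emeasure lborel (U - C) \<le> emeasure lborel (U - A) + emeasure lborel (A - C)"
      by (simp add: emeasure_subadditive)
    also have "\<dots> \<le> ennreal (e / 5) + ennreal (e / 5)"
      using U(3) \<open>emeasure lborel (A - C) < _\<close> by (intro add_mono) auto
    also have "\<dots> = ennreal (2 * e / 5)"
      using \<open>e > 0\<close> by (simp flip: ennreal_plus)
    finally show ?thesis .
  qed
  show "\<forall>\<^sub>F h in nhds 0. (\<integral>\<^sup>+x. ennreal \<bar>indicator A (x + h) - indicator A x\<bar> \<partial>lborel) < ennreal e"
    unfolding eventually_nhds_metric
  proof (intro exI conjI allI impI)
    show "d > 0" by fact
    fix h :: 'a assume "dist h 0 < d"
    then have h: "norm h < d" by simp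
    have "(\<integral>\<^sup>+x. ennreal \<bar>indicator A (x + h) - indicator A x\<bar> \<partial>lborel)
        \<le> (\<integral>\<^sup>+x. indicator (U - C) (x + h) + indicator (U - C) x \<partial>lborel)"
    proof (rule nn_integral_mono)
      fix x
      have "x + h \<in> U" if "x \<in> C"
        using d(2)[OF that, of "x + h"] h by (auto simp: dist_norm)
      moreover have "x \<in> U" if "x + h \<in> C"
        using d(2)[OF that, of x] h by (auto simp: dist_norm)
      ultimately show "ennreal \<bar>indicator A (x + h) - indicator A x\<bar>
          \<le> indicator (U - C) (x + h) + indicator (U - C) x"
        using C(1) U(2) by (auto simp: indicator_def)
    qed
    also have "\<dots> = emeasure lborel (U - C) + emeasure lborel (U - C)"
      by (simp add: nn_integral_add nn_integral_lborel_translate)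
    also have "\<dots> \<le> ennreal (2 * e / 5) + ennreal (2 * e / 5)"
      using UC by (intro add_mono)
    also have "\<dots> < ennreal e"
      using \<open>e > 0\<close> by (simp add: ennreal_lessI flip: ennreal_plus)
    finally show "(\<integral>\<^sup>+x. ennreal \<bar>indicator A (x + h) - indicator A x\<bar> \<partial>lborel) < ennreal e" .
  qed
qed

text \<open>Induction over indicators, sums and dominated limits. In the limit case the increment of
  \<open>f\<close> is compared with that of an approximant \<open>s i\<close>; the two approximation
  errors, at \<open>x + h\<close> and at \<open>x\<close>, have the same integral by translation
  invariance.\<close>

lemma tendsto_translate_L1:
  fixes f :: "'a::euclidean_space \<Rightarrow> real"
  assumes "integrable lborel f"
  shows "((\<lambda>h. \<integral>\<^sup>+x. ennreal \<bar>f (x + h) - f x\<bar> \<partial>lborel) \<longlongrightarrow> 0) (nhds 0)"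
  using assms
proof (induction rule: integrable_induct)
  case (base A c)
  have "((\<lambda>h. ennreal \<bar>c\<bar> * (\<integral>\<^sup>+x. ennreal \<bar>indicator A (x + h) - indicator A x\<bar> \<partial>lborel)) \<longlongrightarrow> ennreal \<bar>c\<bar> * 0) (nhds 0)"
    using base by (intro ennreal_tendsto_cmult tendsto_translate_indicator) auto
  moreover have "ennreal \<bar>c\<bar> * (\<integral>\<^sup>+x. ennreal \<bar>indicator A (x + h) - indicator A x\<bar> \<partial>lborel)
      = (\<integral>\<^sup>+x. ennreal \<bar>indicator A (x + h) *\<^sub>R c - indicator A x *\<^sub>R c\<bar> \<partial>lborel)" for h
  proof -
    have [measurable]: "A \<in> sets borel"
      using base by simp
    have "\<bar>indicator A (x + h) *\<^sub>R c - indicator A x *\<^sub>R c\<bar> = \<bar>c\<bar> * \<bar>indicator A (x + h) - indicator A x\<bar>" for x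
      by (simp add: abs_mult flip: left_diff_distrib)
    then show ?thesis
      by (simp add: ennreal_mult nn_integral_cmult)
  qed
  ultimately show ?case
    by simp
next
  case (add f g)
  have [measurable]: "f \<in> borel_measurable borel" "g \<in> borel_measurable borel"
    using add by auto
  show ?case
  proof (rule tendsto_sandwich[OF _ _ tendsto_const])
    show "((\<lambda>h. (\<integral>\<^sup>+x. ennreal \<bar>f (x + h) - f x\<bar> \<partial>lborel) + (\<integral>\<^sup>+x. ennreal \<bar>g (x + h) - g x\<bar> \<partial>lborel))
        \<longlongrightarrow> 0) (nhds 0)"
      using tendsto_add[OF add.IH] by simp
    show "\<forall>\<^sub>F h in nhds 0. (\<integral>\<^sup>+x. ennreal \<bar>f (x + h) + g (x + h) - (f x + g x)\<bar> \<partial>lborel)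
        \<le> (\<integral>\<^sup>+x. ennreal \<bar>f (x + h) - f x\<bar> \<partial>lborel) + (\<integral>\<^sup>+x. ennreal \<bar>g (x + h) - g x\<bar> \<partial>lborel)"
      by (intro always_eventually allI)
        (auto simp flip: nn_integral_add ennreal_plus intro!: nn_integral_mono ennreal_leI)
  qed auto
next
  case (lim f s)
  have [measurable]: "f \<in> borel_measurable borel" "\<And>i. s i \<in> borel_measurable borel"
    using lim by auto
  have L1: "(\<lambda>i. \<integral>\<^sup>+x. ennreal \<bar>f x - s i x\<bar> \<partial>lborel) \<longlonglongrightarrow> (\<integral>\<^sup>+x. 0 \<partial>(lborel :: 'a measure))"
  \<comment> \<open>The induction rule supplies the bound \<open>2 * norm (f x)\<close> on the
    approximants, so the difference from \<open>f\<close> is at most three times the size of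
    \<open>f\<close>.\<close>
  proof (rule nn_integral_dominated_convergence[where w = "\<lambda>x. ennreal (3 * \<bar>f x\<bar>)"])
    show "AE x in lborel. ennreal \<bar>f x - s j x\<bar> \<le> ennreal (3 * \<bar>f x\<bar>)" for j
    proof (intro AE_I2 ennreal_leI)
      fix x
      have "norm (s j x) \<le> 2 * norm (f x)"
        using lim by simp
      then show "\<bar>f x - s j x\<bar> \<le> 3 * \<bar>f x\<bar>"
        by simp
    qed
    show "AE x in lborel. (\<lambda>i. ennreal \<bar>f x - s i x\<bar>) \<longlonglongrightarrow> 0"
    proof (intro AE_I2)
      fix x
      have "(\<lambda>i. \<bar>f x - s i x\<bar>) \<longlonglongrightarrow> \<bar>f x - f x\<bar>"
        by (intro tendsto_intros lim) simp
      then show "(\<lambda>i. ennreal \<bar>f x - s i x\<bar>) \<longlonglongrightarrow> 0"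
        by (simp add: ennreal_tendsto_0_iff)
    qed
    show "(\<integral>\<^sup>+x. ennreal (3 * \<bar>f x\<bar>) \<partial>lborel) < \<infinity>"
      using \<open>integrable lborel f\<close>
      by (simp add: integrable_iff_bounded ennreal_mult nn_integral_cmult ennreal_mult_less_top)
  qed measurable
  show ?case
  proof (rule tendsto_zero_ennreal)
    fix e :: real assume "e > 0"
    have "\<forall>\<^sub>F i in sequentially. (\<integral>\<^sup>+x. ennreal \<bar>f x - s i x\<bar> \<partial>lborel) < ennreal (e / 4)"
      using L1 \<open>e > 0\<close> by (intro order_tendstoD) auto
    then obtain i where i: "(\<integral>\<^sup>+x. ennreal \<bar>f x - s i x\<bar> \<partial>lborel) < ennreal (e / 4)"
      by (auto simp: eventually_sequentially)
    have "\<forall>\<^sub>F h in nhds 0. (\<integral>\<^sup>+x. ennreal \<bar>s i (x + h) - s i x\<bar> \<partial>lborel) < ennreal (e / 4)"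
      using lim.IH[of i] \<open>e > 0\<close> by (intro order_tendstoD) auto
    then show "\<forall>\<^sub>F h in nhds 0. (\<integral>\<^sup>+x. ennreal \<bar>f (x + h) - f x\<bar> \<partial>lborel) < ennreal e"
    proof eventually_elim
      case (elim h)
      have "(\<integral>\<^sup>+x. ennreal \<bar>f (x + h) - f x\<bar> \<partial>lborel)
          \<le> (\<integral>\<^sup>+x. ennreal \<bar>f (x + h) - s i (x + h)\<bar> + ennreal \<bar>s i (x + h) - s i x\<bar> + ennreal \<bar>f x - s i x\<bar> \<partial>lborel)"
        by (auto simp flip: ennreal_plus intro!: nn_integral_mono ennreal_leI)
      also have "\<dots> = (\<integral>\<^sup>+x. ennreal \<bar>f x - s i x\<bar> \<partial>lborel) + (\<integral>\<^sup>+x. ennreal \<bar>s i (x + h) - s i x\<bar> \<partial>lborel)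
           + (\<integral>\<^sup>+x. ennreal \<bar>f x - s i x\<bar> \<partial>lborel)"
        using nn_integral_lborel_translate[of "\<lambda>x. ennreal \<bar>f x - s i x\<bar>" h]
        by (simp add: nn_integral_add)
      also have "\<dots> \<le> ennreal (e / 4) + ennreal (e / 4) + ennreal (e / 4)"
        using i elim by (intro add_mono) auto
      also have "\<dots> < ennreal e"
        using \<open>e > 0\<close> by (simp add: ennreal_lessI flip: ennreal_plus)
      finally show ?case .
    qed
  qed
qed

text \<open>
  Cut \<open>f\<close> off in height and in space at level \<open>n\<close>.  The squared increments of the resulting \<open>g n\<close>
  are at most \<open>2 n\<close> times its increments, so they are controlled in \<open>L1\<close>.
\<close>

lemma tendsto_translate_L2:
  fixes f :: "'a::euclidean_space \<Rightarrow> real"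
  assumes [measurable]: "f \<in> borel_measurable borel"
    and L2: "(\<integral>\<^sup>+x. ennreal ((f x)\<^sup>2) \<partial>lborel) < \<infinity>"
  shows "((\<lambda>h. \<integral>\<^sup>+x. ennreal ((f (x + h) - f x)\<^sup>2) \<partial>lborel) \<longlongrightarrow> 0) (nhds 0)"
proof -
  define g where "g n x = (if norm x \<le> real n then max (- real n) (min (real n) (f x)) else 0)" for n x
  have [measurable]: "g n \<in> borel_measurable borel" for n
    unfolding g_def by measurable
  have g_bound: "\<bar>g n x\<bar> \<le> real n" for n x
    by (auto simp: g_def)
  have g_le: "\<bar>f x - g n x\<bar> \<le> \<bar>f x\<bar>" for n x
    by (auto simp: g_def)
  have g_int: "integrable lborel (g n)" for n
  proof (rule Bochner_Integration.integrable_bound)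
    show "integrable lborel (\<lambda>x. real n * indicator (cball 0 (real n)) x :: real)"
      by (intro integrable_mult_right integrable_real_indicator) (use emeasure_bounded_finite[OF bounded_cball] in auto)
    show "AE x in lborel. norm (g n x) \<le> norm (real n * indicator (cball 0 (real n)) x :: real)"
      by (auto simp: g_def indicator_def)
  qed measurable
  have g_lim: "(\<lambda>n. (f x - g n x)\<^sup>2) \<longlonglongrightarrow> 0" for x
  \<comment> \<open>At a fixed point the cutoff is inactive as soon as \<open>n\<close> exceeds both
    \<open>norm x\<close> and the absolute value of \<open>f x\<close>.\<close>
  proof (rule tendsto_eventually)
    show "\<forall>\<^sub>F n in sequentially. (f x - g n x)\<^sup>2 = 0"
      using eventually_ge_at_top[of "nat \<lceil>max (norm x) \<bar>f x\<bar>\<rceil>"]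
    proof eventually_elim
      case (elim n)
      then have "max (norm x) \<bar>f x\<bar> \<le> real n"
        by (simp add: nat_ceiling_le_eq)
      then show ?case
        by (auto simp: g_def)
    qed
  qed
  have lim: "(\<lambda>n. \<integral>\<^sup>+x. ennreal ((f x - g n x)\<^sup>2) \<partial>lborel) \<longlonglongrightarrow> (\<integral>\<^sup>+x. 0 \<partial>(lborel :: 'a measure))"
  proof (rule nn_integral_dominated_convergence[where w = "\<lambda>x. ennreal ((f x)\<^sup>2)"])
    show "AE x in lborel. ennreal ((f x - g j x)\<^sup>2) \<le> ennreal ((f x)\<^sup>2)" for j
      using g_le by (auto intro!: ennreal_leI simp: abs_le_square_iff[symmetric])
    show "AE x in lborel. (\<lambda>n. ennreal ((f x - g n x)\<^sup>2)) \<longlonglongrightarrow> 0"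
      using g_lim by (simp add: ennreal_tendsto_0_iff)
  qed (use L2 in auto)
  show ?thesis
  proof (rule tendsto_zero_ennreal)
    fix e :: real assume "e > 0"
    \<comment> \<open>Three terms of size \<open>e / 12\<close>, with the factor 3 from squaring a
      sum of three, add up to \<open>3 * e / 4 < e\<close>.\<close>
    have "\<forall>\<^sub>F n in sequentially. (\<integral>\<^sup>+x. ennreal ((f x - g n x)\<^sup>2) \<partial>lborel) < ennreal (e / 12)"
      using lim \<open>e > 0\<close> by (intro order_tendstoD) auto
    then obtain n where n: "(\<integral>\<^sup>+x. ennreal ((f x - g n x)\<^sup>2) \<partial>lborel) < ennreal (e / 12)"
      by (auto simp: eventually_sequentially)
    have "((\<lambda>h. ennreal (2 * real n) * (\<integral>\<^sup>+x. ennreal \<bar>g n (x + h) - g n x\<bar> \<partial>lborel))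
        \<longlongrightarrow> ennreal (2 * real n) * 0) (nhds 0)"
      by (intro ennreal_tendsto_cmult tendsto_translate_L1 g_int) auto
    then have "\<forall>\<^sub>F h in nhds 0. ennreal (2 * real n) * (\<integral>\<^sup>+x. ennreal \<bar>g n (x + h) - g n x\<bar> \<partial>lborel)
        < ennreal (e / 12)"
      using \<open>e > 0\<close> by (intro order_tendstoD) auto
    then show "\<forall>\<^sub>F h in nhds 0. (\<integral>\<^sup>+x. ennreal ((f (x + h) - f x)\<^sup>2) \<partial>lborel) < ennreal e"
    proof eventually_elim
      case (elim h)
      have sq: "(f (x + h) - f x)\<^sup>2
          \<le> 3 * ((f (x + h) - g n (x + h))\<^sup>2 + 2 * real n * \<bar>g n (x + h) - g n x\<bar> + (f x - g n x)\<^sup>2)" for x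
      proof -
        \<comment> \<open>The difference of the two sides is the sum of the squares of the pairwise
          differences.\<close>
        have "(p + q + r)\<^sup>2 \<le> 3 * (p\<^sup>2 + q\<^sup>2 + r\<^sup>2)" for p q r :: real
          using zero_le_power2[of "p - q"] zero_le_power2[of "q - r"] zero_le_power2[of "p - r"]
          by (simp add: power2_eq_square algebra_simps)
        from this[of "f (x + h) - g n (x + h)" "g n (x + h) - g n x" "g n x - f x"]
        have le: "(f (x + h) - f x)\<^sup>2
            \<le> 3 * ((f (x + h) - g n (x + h))\<^sup>2 + (g n (x + h) - g n x)\<^sup>2 + (f x - g n x)\<^sup>2)"
          by (simp add: power2_commute)
        have "(g n (x + h) - g n x)\<^sup>2 \<le> 2 * real n * \<bar>g n (x + h) - g n x\<bar>"
        proof -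
          have "\<bar>g n (x + h) - g n x\<bar> \<le> 2 * real n"
            using g_bound[of n x] g_bound[of n "x + h"] by linarith
          then have "\<bar>g n (x + h) - g n x\<bar> * \<bar>g n (x + h) - g n x\<bar> \<le> 2 * real n * \<bar>g n (x + h) - g n x\<bar>"
            by (intro mult_right_mono) auto
          then show ?thesis
            by (simp add: power2_eq_square)
        qed
        then show ?thesis
          by (intro order_trans[OF le] mult_left_mono add_mono) auto
      qed
      have ennreal_eq: "ennreal (3 * (p + q * r + s)) = 3 * (ennreal p + ennreal q * ennreal r + ennreal s)"
        if "p \<ge> 0" "q \<ge> 0" "r \<ge> 0" "s \<ge> 0" for p q r s :: real
        using that by (simp add: ennreal_mult ennreal_plus)
      have "(\<integral>\<^sup>+x. ennreal ((f (x + h) - f x)\<^sup>2) \<partial>lborel)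
          \<le> (\<integral>\<^sup>+x. 3 * (ennreal ((f (x + h) - g n (x + h))\<^sup>2)
                 + ennreal (2 * real n) * ennreal \<bar>g n (x + h) - g n x\<bar> + ennreal ((f x - g n x)\<^sup>2)) \<partial>lborel)"
      proof (rule nn_integral_mono)
        fix x
        have "ennreal ((f (x + h) - f x)\<^sup>2) \<le> ennreal (3 * ((f (x + h) - g n (x + h))\<^sup>2
            + 2 * real n * \<bar>g n (x + h) - g n x\<bar> + (f x - g n x)\<^sup>2))"
          using sq by (rule ennreal_leI)
        also have "\<dots> = 3 * (ennreal ((f (x + h) - g n (x + h))\<^sup>2)
                 + ennreal (2 * real n) * ennreal \<bar>g n (x + h) - g n x\<bar> + ennreal ((f x - g n x)\<^sup>2))"
          by (intro ennreal_eq) auto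
        finally show "ennreal ((f (x + h) - f x)\<^sup>2) \<le> \<dots>" .
      qed
      also have "\<dots> = 3 * ((\<integral>\<^sup>+x. ennreal ((f x - g n x)\<^sup>2) \<partial>lborel)
          + ennreal (2 * real n) * (\<integral>\<^sup>+x. ennreal \<bar>g n (x + h) - g n x\<bar> \<partial>lborel)
          + (\<integral>\<^sup>+x. ennreal ((f x - g n x)\<^sup>2) \<partial>lborel))"
        using nn_integral_lborel_translate[of "\<lambda>x. ennreal ((f x - g n x)\<^sup>2)" h]
        by (simp add: nn_integral_add nn_integral_cmult)
      also have "\<dots> \<le> 3 * (ennreal (e / 12) + ennreal (e / 12) + ennreal (e / 12))"
        using n elim by (intro mult_left_mono add_mono) auto
      \<comment> \<open>The factor 1 gives the middle term the product form that
        \<open>ennreal_eq\<close> expects.\<close>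
      also have "\<dots> = ennreal (3 * (e / 12 + e / 12 * 1 + e / 12))"
        using \<open>e > 0\<close> by (subst ennreal_eq) auto
      also have "\<dots> < ennreal e"
        using \<open>e > 0\<close> by (intro ennreal_lessI) auto
      finally show ?case .
    qed
  qed
qed

subsection \<open>The nonlocal energy\<close>

text \<open>By \<open>nn_integral_linear\<close>, the preimage of a Borel null set has measure
  \<open>c * 0\<close>. This makes it legitimate to replace a Lebesgue measurable function by a
  Borel version inside a composition with \<open>a\<close>.\<close>

lemma AE_lborel_linear:
  fixes a :: "'a::euclidean_space \<Rightarrow> 'a"
  assumes a: "linear a" "bij a" and P: "AE x in lborel. P x"
  shows "AE x in lborel. P (a x)"
proof -
  obtain N where N: "{x. \<not> P x} \<subseteq> N" "N \<in> sets borel" "emeasure lborel N = 0"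
    using P by (auto elim!: AE_E)
  note [measurable] = linear_borel_measurable[OF a(1)] N(2)
  obtain c where "(\<integral>\<^sup>+x. indicator N (a x) \<partial>lborel) = ennreal c * (\<integral>\<^sup>+x. indicator N x \<partial>lborel)"
    using nn_integral_linear[OF a] N(2) by (metis borel_measurable_indicator)
  also have "\<dots> = 0"
    using N by simp
  finally have "AE x in lborel. indicator N (a x) = (0 :: ennreal)"
    by (simp add: nn_integral_0_iff_AE)
  then show ?thesis
    using N(1) by (auto elim!: eventually_mono split: split_indicator_asm)
qed

lemma AE_lborel_reflect:
  fixes P :: "'a::euclidean_space \<Rightarrow> bool"
  assumes P: "AE x in lborel. P x"
  shows "AE x in lborel. P (c - x)"
proof -
  obtain N where N: "{x. \<not> P x} \<subseteq> N" "N \<in> sets borel" "emeasure lborel N = 0"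
    using P by (auto elim!: AE_E)
  note [measurable] = N(2)
  have "(\<integral>\<^sup>+x. indicator N (c - x) \<partial>lborel) = (0 :: ennreal)"
    using N by (simp add: nn_integral_lborel_reflect)
  then have "AE x in lborel. indicator N (c - x) = (0 :: ennreal)"
    by (simp add: nn_integral_0_iff_AE)
  then show ?thesis
    using N(1) by (auto elim!: eventually_mono split: split_indicator_asm)
qed

text \<open>The two kernel terms are exchanged by swapping \<open>x\<close> and \<open>y\<close>, so
  by Tonelli they contribute equally. In the remaining one the substitution
  \<open>y = a x + z\<close> frees \<open>\<psi>\<close> from \<open>x\<close>, and a second use of
  Tonelli puts the integral over \<open>z\<close> outside.\<close>

lemma nonlocal_energy_eq:
  fixes \<psi> u :: "'a::euclidean_space \<Rightarrow> real"
  assumes [measurable]: "\<psi> \<in> borel_measurable borel" "u \<in> borel_measurable borel"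
      "a \<in> borel_measurable borel"
    and nonneg: "\<And>x. \<psi> x \<ge> 0"
  shows "(\<integral>\<^sup>+y. (\<integral>\<^sup>+x. ennreal ((\<psi> (y - a x) + \<psi> (x - a y)) * (u x - u y)\<^sup>2) \<partial>lborel) \<partial>lborel)
    = 2 * (\<integral>\<^sup>+z. ennreal (\<psi> z) * (\<integral>\<^sup>+x. ennreal ((u x - u (a x + z))\<^sup>2) \<partial>lborel) \<partial>lborel)"
proof -
  let ?I = "\<integral>\<^sup>+x. (\<integral>\<^sup>+y. ennreal (\<psi> (y - a x)) * ennreal ((u x - u y)\<^sup>2) \<partial>lborel) \<partial>lborel"
  have "(\<integral>\<^sup>+y. (\<integral>\<^sup>+x. ennreal ((\<psi> (y - a x) + \<psi> (x - a y)) * (u x - u y)\<^sup>2) \<partial>lborel) \<partial>lborel)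
      = (\<integral>\<^sup>+y. (\<integral>\<^sup>+x. ennreal (\<psi> (y - a x)) * ennreal ((u x - u y)\<^sup>2)
           + ennreal (\<psi> (x - a y)) * ennreal ((u y - u x)\<^sup>2) \<partial>lborel) \<partial>lborel)"
    using nonneg by (simp add: ennreal_mult ennreal_plus distrib_right power2_commute)
  \<comment> \<open>The second summand is \<open>?I\<close> itself after renaming the bound
    variables.\<close>
  also have "\<dots> = (\<integral>\<^sup>+y. (\<integral>\<^sup>+x. ennreal (\<psi> (y - a x)) * ennreal ((u x - u y)\<^sup>2) \<partial>lborel) \<partial>lborel) + ?I"
    by (simp add: nn_integral_add)
  also have "(\<integral>\<^sup>+y. (\<integral>\<^sup>+x. ennreal (\<psi> (y - a x)) * ennreal ((u x - u y)\<^sup>2) \<partial>lborel) \<partial>lborel) = ?I"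
    by (rule lborel_pair.Fubini') measurable
  also have "?I + ?I = 2 * ?I"
    by (simp add: mult_2)
  also have "?I = (\<integral>\<^sup>+x. (\<integral>\<^sup>+z. ennreal (\<psi> z) * ennreal ((u x - u (a x + z))\<^sup>2) \<partial>lborel) \<partial>lborel)"
  proof (rule nn_integral_cong)
    fix x
    show "(\<integral>\<^sup>+y. ennreal (\<psi> (y - a x)) * ennreal ((u x - u y)\<^sup>2) \<partial>lborel)
        = (\<integral>\<^sup>+z. ennreal (\<psi> z) * ennreal ((u x - u (a x + z))\<^sup>2) \<partial>lborel)"
      using nn_integral_lborel_translate[of "\<lambda>y. ennreal (\<psi> (y - a x)) * ennreal ((u x - u y)\<^sup>2)" "a x"]
      by (simp add: add.commute)
  qed
  also have "\<dots> = (\<integral>\<^sup>+z. (\<integral>\<^sup>+x. ennreal (\<psi> z) * ennreal ((u x - u (a x + z))\<^sup>2) \<partial>lborel) \<partial>lborel)"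
    by (rule lborel_pair.Fubini') measurable
  finally show ?thesis
    by (simp add: nn_integral_cmult)
qed

text \<open>For each fixed \<open>y\<close> the arguments \<open>y - a x\<close> and
  \<open>x - a y\<close> are invertible affine functions of \<open>x\<close>, so an exceptional null
  set of \<open>\<psi>\<close> pulls back to null sets.\<close>

lemma nonlocal_energy_cong_AE:
  fixes \<psi> \<psi>' u :: "'a::euclidean_space \<Rightarrow> real"
  assumes a: "linear a" "bij a" and eq: "AE x in lborel. \<psi> x = \<psi>' x"
  shows "(\<integral>\<^sup>+y. (\<integral>\<^sup>+x. ennreal ((\<psi> (y - a x) + \<psi> (x - a y)) * (u x - u y)\<^sup>2) \<partial>lborel) \<partial>lborel)
       = (\<integral>\<^sup>+y. (\<integral>\<^sup>+x. ennreal ((\<psi>' (y - a x) + \<psi>' (x - a y)) * (u x - u y)\<^sup>2) \<partial>lborel) \<partial>lborel)"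
proof (rule nn_integral_cong, rule nn_integral_cong_AE)
  fix y
  have "AE x in lborel. \<psi> (y - a x) = \<psi>' (y - a x)"
    by (rule AE_lborel_linear[OF a, of "\<lambda>z. \<psi> (y - z) = \<psi>' (y - z)"]) (rule AE_lborel_reflect[OF eq])
  moreover have "AE x in lborel. \<psi> (x - a y) = \<psi>' (x - a y)"
    \<comment> \<open>The translation by \<open>- a y\<close> is written as a composition of two
      reflections.\<close>
    using AE_lborel_reflect[OF AE_lborel_reflect[OF eq, of "- a y"], of 0]
    by (simp add: algebra_simps)
  ultimately show "AE x in lborel. ennreal ((\<psi> (y - a x) + \<psi> (x - a y)) * (u x - u y)\<^sup>2)
      = ennreal ((\<psi>' (y - a x) + \<psi>' (x - a y)) * (u x - u y)\<^sup>2)"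
    by eventually_elim simp
qed

text \<open>Young's inequality, from \<open>(t * p - q)\<^sup>2 \<ge> 0\<close> divided by
  \<open>t\<close>. The weight matters: small \<open>t\<close> keeps the coefficient of
  \<open>p\<^sup>2\<close> close to 1, so the limit integral is not inflated.\<close>

lemma square_add_le_weighted:
  fixes p q t :: real
  assumes "t > 0"
  shows "(p + q)\<^sup>2 \<le> (1 + t) * p\<^sup>2 + (1 + 1 / t) * q\<^sup>2"
proof -
  have "0 \<le> (t * p - q)\<^sup>2 / t"
    using assms by simp
  also have "\<dots> = t * p\<^sup>2 - 2 * p * q + q\<^sup>2 / t"
    using assms by (simp add: power2_eq_square field_simps)
  finally show ?thesis
    by (simp add: power2_sum algebra_simps)
qed

text \<open>Insert \<open>\<phi> (a x)\<close> between the two values. The unperturbed increment is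
  multiplied only by \<open>1 + t\<close>; the other part depends on \<open>a x\<close> alone, so a
  linear change of variables turns it into a constant times the squared translation increment of
  \<open>\<phi>\<close>, which vanishes as \<open>h\<close> tends to 0.\<close>

lemma eventually_translate_increment_le:
  fixes \<phi> :: "'a::euclidean_space \<Rightarrow> real"
  assumes a: "linear a" "bij a" and [measurable]: "\<phi> \<in> borel_measurable borel"
    and L2: "(\<integral>\<^sup>+x. ennreal ((\<phi> x)\<^sup>2) \<partial>lborel) < \<infinity>" and "e > 0"
  shows "\<forall>\<^sub>F h in nhds 0. (\<integral>\<^sup>+x. ennreal ((\<phi> x - \<phi> (a x + h))\<^sup>2) \<partial>lborel)
       \<le> (\<integral>\<^sup>+x. ennreal ((\<phi> x - \<phi> (a x))\<^sup>2) \<partial>lborel) + ennreal e"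
proof (cases "(\<integral>\<^sup>+x. ennreal ((\<phi> x - \<phi> (a x))\<^sup>2) \<partial>lborel)")
  case top
  then show ?thesis
    by simp
next
  case (real r)
  note [measurable] = linear_borel_measurable[OF a(1)]
  \<comment> \<open>Chosen so that \<open>t * r \<le> e / 2\<close>, including the case
    \<open>r = 0\<close>.\<close>
  define t where "t = e / (2 * (r + 1))"
  have "t > 0"
    using real \<open>e > 0\<close> by (simp add: t_def)
  have "t * r \<le> t * (r + 1)"
    using \<open>t > 0\<close> by simp
  also have "\<dots> = e / 2"
    using real by (simp add: t_def field_simps)
  finally have tr: "(1 + t) * r \<le> r + e / 2"
    by (simp add: algebra_simps)
  obtain c where c: "c > 0" "\<And>g. g \<in> borel_measurable borel \<Longrightarrow>
       (\<integral>\<^sup>+x. g (a x) \<partial>lborel) = ennreal c * (\<integral>\<^sup>+x. g x \<partial>lborel)"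
    using nn_integral_linear[OF a] by metis
  have "((\<lambda>h. ennreal ((1 + 1 / t) * c) * (\<integral>\<^sup>+x. ennreal ((\<phi> (x + h) - \<phi> x)\<^sup>2) \<partial>lborel))
      \<longlongrightarrow> ennreal ((1 + 1 / t) * c) * 0) (nhds 0)"
    using L2 by (intro ennreal_tendsto_cmult tendsto_translate_L2) auto
  then have "\<forall>\<^sub>F h in nhds 0. ennreal ((1 + 1 / t) * c) * (\<integral>\<^sup>+x. ennreal ((\<phi> (x + h) - \<phi> x)\<^sup>2) \<partial>lborel)
      < ennreal (e / 2)"
    using \<open>e > 0\<close> by (intro order_tendstoD) auto
  then show ?thesis
  proof eventually_elim
    case (elim h)
    have "(\<integral>\<^sup>+x. ennreal ((\<phi> x - \<phi> (a x + h))\<^sup>2) \<partial>lborel)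
        \<le> (\<integral>\<^sup>+x. ennreal (1 + t) * ennreal ((\<phi> x - \<phi> (a x))\<^sup>2)
             + ennreal (1 + 1 / t) * ennreal ((\<phi> (a x + h) - \<phi> (a x))\<^sup>2) \<partial>lborel)"
    proof (rule nn_integral_mono)
      fix x
      have "ennreal ((\<phi> x - \<phi> (a x + h))\<^sup>2)
          \<le> ennreal ((1 + t) * (\<phi> x - \<phi> (a x))\<^sup>2 + (1 + 1 / t) * (\<phi> (a x + h) - \<phi> (a x))\<^sup>2)"
        using square_add_le_weighted[OF \<open>t > 0\<close>, of "\<phi> x - \<phi> (a x)" "\<phi> (a x) - \<phi> (a x + h)"]
        by (intro ennreal_leI) (simp add: power2_commute)
      also have "\<dots> = ennreal (1 + t) * ennreal ((\<phi> x - \<phi> (a x))\<^sup>2)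
             + ennreal (1 + 1 / t) * ennreal ((\<phi> (a x + h) - \<phi> (a x))\<^sup>2)"
        using \<open>t > 0\<close> by (simp add: ennreal_plus ennreal_mult del: ennreal_plus[symmetric])
      finally show "ennreal ((\<phi> x - \<phi> (a x + h))\<^sup>2) \<le> \<dots>" .
    qed
    also have "\<dots> = ennreal (1 + t) * ennreal r
        + ennreal (1 + 1 / t) * (\<integral>\<^sup>+x. ennreal ((\<phi> (a x + h) - \<phi> (a x))\<^sup>2) \<partial>lborel)"
      using real by (simp add: nn_integral_add nn_integral_cmult)
    also have "(\<integral>\<^sup>+x. ennreal ((\<phi> (a x + h) - \<phi> (a x))\<^sup>2) \<partial>lborel)
        = ennreal c * (\<integral>\<^sup>+x. ennreal ((\<phi> (x + h) - \<phi> x)\<^sup>2) \<partial>lborel)"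
      by (rule c(2)) measurable
    also have "ennreal (1 + t) * ennreal r + ennreal (1 + 1 / t) * \<dots>
        \<le> ennreal ((1 + t) * r) + ennreal (e / 2)"
      using elim real \<open>t > 0\<close> c(1) by (intro add_mono) (auto simp: ennreal_mult mult.assoc)
    also have "\<dots> \<le> ennreal (r + e / 2) + ennreal (e / 2)"
      using tr by (intro add_mono ennreal_leI) auto
    also have "\<dots> = ennreal r + ennreal e"
      using real \<open>e > 0\<close> by (simp flip: ennreal_plus)
    finally show ?case
      using real by simp
  qed
qed

section \<open>Admissible functions and the scaled test functions\<close>

lemma in_L2_borelI:
  assumes "u \<in> borel_measurable borel" "(\<integral>\<^sup>+x. ennreal ((u x)\<^sup>2) \<partial>lborel) < \<infinity>"
  shows "u \<in> L2"
  using assms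
  by (auto simp: L2_def integrable_iff_bounded nn_integral_completion measurable_completion
      intro!: measurable_completion)

text \<open>The function vanishes almost everywhere off the ball, so the normalization there is one
  on the whole space, as the denominator of the quotient requires.\<close>

lemma nn_integral_square_admissible:
  assumes "\<phi> \<in> admissible"
  shows "(\<integral>\<^sup>+x. ennreal ((\<phi> x)\<^sup>2) \<partial>lebesgue) = 1"
proof -
  have [measurable]: "\<phi> \<in> borel_measurable lebesgue" and int: "integrable lebesgue (\<lambda>x. (\<phi> x)\<^sup>2)"
    and supp: "AE x in lebesgue. x \<notin> cball 0 1 \<longrightarrow> \<phi> x = 0"
    and norm: "L2_norm_on (cball 0 1) \<phi> = 1"
    using assms by (auto simp: admissible_def L2_def)
  have "(LINT x|lebesgue. (\<phi> x)\<^sup>2) = (LINT x:cball 0 1|lebesgue. (\<phi> x)\<^sup>2)"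
    unfolding set_lebesgue_integral_def
  proof (rule integral_cong_AE)
    show "AE x in lebesgue. (\<phi> x)\<^sup>2 = indicat_real (cball 0 1) x *\<^sub>R (\<phi> x)\<^sup>2"
      using supp by eventually_elim (auto simp: indicator_def)
  qed (auto intro!: borel_measurable_indicator borel_measurable_times borel_measurable_integrable[OF int])
  also have "\<dots> = 1"
    using norm by (simp add: L2_norm_on_def)
  finally show ?thesis
    using int by (simp add: nn_integral_eq_integral)
qed

text \<open>The witness is the normalized indicator of the ball. Nonemptiness is what lets a
  constant be moved inside the infimum in the final step.\<close>

lemma admissible_nonempty: "(admissible :: ('a::euclidean_space \<Rightarrow> real) set) \<noteq> {}"
proof -
  let ?B = "cball 0 1 :: 'a set"
  define m where "m = measure lebesgue ?B"
  have fin: "emeasure lebesgue ?B < \<infinity>"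
    using emeasure_bounded_finite[OF bounded_cball, of 0 1] by simp
  have "m > 0"
    unfolding m_def using content_cball_pos[of 1 "0 :: 'a"] by simp
  define \<phi> where "\<phi> x = indicat_real ?B x / sqrt m" for x
  have sq: "(\<phi> x)\<^sup>2 = indicat_real ?B x / m" for x
    using \<open>m > 0\<close> by (simp add: \<phi>_def indicator_def power_divide)
  have "\<phi> \<in> admissible"
    unfolding admissible_def L2_def mem_Collect_eq
  proof (intro conjI)
    show "\<phi> \<in> borel_measurable lebesgue"
      unfolding \<phi>_def by (intro borel_measurable_divide borel_measurable_indicator) auto
    show "integrable lebesgue (\<lambda>x. (\<phi> x)\<^sup>2)"
      unfolding sq using fin by (intro integrable_divide integrable_real_indicator) auto
    show "AE x in lebesgue. x \<notin> ?B \<longrightarrow> \<phi> x = 0"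
      by (simp add: \<phi>_def)
    have "(LINT x:?B|lebesgue. (\<phi> x)\<^sup>2) = (LINT x|lebesgue. indicat_real ?B x / m)"
      unfolding set_lebesgue_integral_def sq by (intro Bochner_Integration.integral_cong) (auto simp: indicator_def)
    also have "\<dots> = 1"
      using \<open>m > 0\<close> fin by (simp add: m_def)
    finally show "L2_norm_on ?B \<phi> = 1"
      by (simp add: L2_norm_on_def)
  qed
  then show ?thesis
    by blast
qed

text \<open>Multiplication by a finite constant is monotone and continuous on
  \<open>ennreal\<close>. For empty \<open>A\<close> the identity fails at \<open>c = 0\<close>,
  where the left side is 0 and the right side infinite.\<close>

lemma mult_INF_ennreal:
  fixes c :: ennreal
  assumes "c < \<infinity>" "A \<noteq> {}"
  shows "c * (INF x\<in>A. f x) = (INF x\<in>A. c * f x)"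
proof -
  have "continuous_on UNIV (\<lambda>x. c * x)"
    using assms by (intro ennreal_continuous_on_cmult) auto
  then have "c * (INF x\<in>A. f x) = (INF y\<in>f ` A. c * y)"
    using assms
    by (intro continuous_at_Inf_mono)
      (auto simp: mono_def mult_left_mono continuous_on_eq_continuous_within continuous_at_imp_continuous_at_within)
  then show ?thesis
    by (simp add: image_image)
qed

text \<open>The bound is proved for one admissible function at a time, with Borel versions of
  \<open>\<phi>\<close> and \<open>\<psi>\<close>. An error \<open>e\<close> is first allowed in the
  increment integral and then removed, using that the integral of \<open>\<psi>\<close> is
  finite.\<close>

lemma lambda1_le_admissible:
  fixes \<psi> :: "'a::euclidean_space \<Rightarrow> real"
  assumes a: "linear a" "bij a"
    and nonneg: "\<And>x. \<psi> x \<ge> 0"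
    and meas: "\<psi> \<in> borel_measurable lebesgue"
    and supp: "\<And>x. x \<notin> cball 0 1 \<Longrightarrow> \<psi> x = 0"
    and fin: "(\<integral>\<^sup>+x. ennreal (\<psi> x) \<partial>lebesgue) < \<infinity>"
    and adm: "\<phi> \<in> admissible"
  shows "lambda1 (\<lambda>x y. \<psi> (y - a x) + \<psi> (x - a y)) \<le>
    2 * (\<integral>\<^sup>+x. ennreal (\<psi> x) \<partial>lebesgue) * (\<integral>\<^sup>+x. ennreal ((\<phi> x - \<phi> (a x))\<^sup>2) \<partial>lebesgue)"
proof -
  note [measurable] = linear_borel_measurable[OF a(1)]
  obtain \<phi>' where [measurable]: "\<phi>' \<in> borel_measurable borel" and \<phi>': "AE x in lborel. \<phi> x = \<phi>' x"
    using completion_ex_borel_measurable_real[of \<phi> lborel] adm by (auto simp: admissible_def L2_def)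
  have norm: "(\<integral>\<^sup>+x. ennreal ((\<phi>' x)\<^sup>2) \<partial>lborel) = 1"
  proof -
    have "(\<integral>\<^sup>+x. ennreal ((\<phi>' x)\<^sup>2) \<partial>lborel) = (\<integral>\<^sup>+x. ennreal ((\<phi> x)\<^sup>2) \<partial>lborel)"
      using \<phi>' by (intro nn_integral_cong_AE) (auto elim!: eventually_mono)
    then show ?thesis
      using nn_integral_square_admissible[OF adm] by (simp add: nn_integral_completion)
  qed
  define F where "F = (\<integral>\<^sup>+x. ennreal ((\<phi>' x - \<phi>' (a x))\<^sup>2) \<partial>lborel)"
  have F: "(\<integral>\<^sup>+x. ennreal ((\<phi> x - \<phi> (a x))\<^sup>2) \<partial>lebesgue) = F"
    unfolding F_def nn_integral_completion
  proof (rule nn_integral_cong_AE)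
    show "AE x in lborel. ennreal ((\<phi> x - \<phi> (a x))\<^sup>2) = ennreal ((\<phi>' x - \<phi>' (a x))\<^sup>2)"
      using \<phi>' AE_lborel_linear[OF a \<phi>'] by eventually_elim simp
  qed
  obtain \<psi>\<^sub>0 where \<psi>\<^sub>0: "\<psi>\<^sub>0 \<in> borel_measurable borel" "AE x in lborel. \<psi> x = \<psi>\<^sub>0 x"
    using completion_ex_borel_measurable_real[of \<psi> lborel] meas by auto
  \<comment> \<open>Truncation at 0 makes the Borel version nonnegative everywhere, as
    \<open>nonlocal_energy_eq\<close> demands; since \<open>\<psi>\<close> is nonnegative, almost
    everywhere equality survives.\<close>
  define \<psi>' where "\<psi>' x = max 0 (\<psi>\<^sub>0 x)" for x
  have [measurable]: "\<psi>' \<in> borel_measurable borel"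
    unfolding \<psi>'_def using \<psi>\<^sub>0(1) by measurable
  have \<psi>'_nonneg: "\<psi>' x \<ge> 0" for x
    by (simp add: \<psi>'_def)
  have \<psi>': "AE x in lborel. \<psi> x = \<psi>' x"
    using \<psi>\<^sub>0(2) by eventually_elim (metis \<psi>'_def max.absorb2 nonneg)
  define J where "J = (\<integral>\<^sup>+x. ennreal (\<psi>' x) \<partial>lborel)"
  have J: "(\<integral>\<^sup>+x. ennreal (\<psi> x) \<partial>lebesgue) = J"
    unfolding J_def nn_integral_completion
    using \<psi>' by (intro nn_integral_cong_AE) (auto elim!: eventually_mono)
  have le: "lambda1 (\<lambda>x y. \<psi> (y - a x) + \<psi> (x - a y)) \<le> 2 * J * (F + ennreal e)" if "e > 0" for e
  proof -
    have "\<forall>\<^sub>F h in nhds 0. (\<integral>\<^sup>+x. ennreal ((\<phi>' x - \<phi>' (a x + h))\<^sup>2) \<partial>lborel) \<le> F + ennreal e"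
      unfolding F_def using norm that by (intro eventually_translate_increment_le a) auto
    then obtain d where "d > 0" and d: "\<And>h. norm h < d \<Longrightarrow>
        (\<integral>\<^sup>+x. ennreal ((\<phi>' x - \<phi>' (a x + h))\<^sup>2) \<partial>lborel) \<le> F + ennreal e"
      by (auto simp: eventually_nhds_metric)
    \<comment> \<open>Any positive scale below \<open>d\<close> would do: then
      \<open>s *\<^sub>R z\<close> has norm below \<open>d\<close> for every \<open>z\<close> in the
      unit ball, so one scale serves the whole support of \<open>\<psi>\<close>.\<close>
    define s where "s = d / 2"
    have "s > 0" "s < d"
      using \<open>d > 0\<close> by (auto simp: s_def)
    have "linear ((*\<^sub>R) s :: 'a \<Rightarrow> 'a)" "bij ((*\<^sub>R) s :: 'a \<Rightarrow> 'a)"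
      using \<open>s > 0\<close> by (auto intro!: bij_betw_byWitness[where f' = "(*\<^sub>R) (1 / s)"] linear_scale_self)
    \<comment> \<open>The value of \<open>c\<close> is irrelevant, since it appears in both
      numerator and denominator.\<close>
    then obtain c where "c > 0" and c: "\<And>g :: 'a \<Rightarrow> ennreal. g \<in> borel_measurable borel \<Longrightarrow>
       (\<integral>\<^sup>+x. g (s *\<^sub>R x) \<partial>lborel) = ennreal c * (\<integral>\<^sup>+x. g x \<partial>lborel)"
      using nn_integral_linear by metis
    define u where "u x = \<phi>' (s *\<^sub>R x)" for x
    have [measurable]: "u \<in> borel_measurable borel"
      unfolding u_def by measurable
    have u2: "(\<integral>\<^sup>+x. ennreal ((u x)\<^sup>2) \<partial>lborel) = ennreal c"
      unfolding u_def using c[of "\<lambda>x. ennreal ((\<phi>' x)\<^sup>2)"] norm by simp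
    have "\<not> (AE x in lebesgue. u x = 0)"
    proof
      assume "AE x in lebesgue. u x = 0"
      then have "AE x in lborel. ennreal ((u x)\<^sup>2) = 0"
        by (auto simp: AE_completion_iff elim!: eventually_mono)
      then have "(\<integral>\<^sup>+x. ennreal ((u x)\<^sup>2) \<partial>lborel) = 0"
        by (simp add: nn_integral_0_iff_AE)
      then show False
        using u2 \<open>c > 0\<close> by simp
    qed
    moreover have "u \<in> L2"
      using u2 by (intro in_L2_borelI) auto
    ultimately have "lambda1 (\<lambda>x y. \<psi> (y - a x) + \<psi> (x - a y))
        \<le> (\<integral>\<^sup>+y. (\<integral>\<^sup>+x. ennreal ((\<psi> (y - a x) + \<psi> (x - a y)) * (u x - u y)\<^sup>2) \<partial>lborel) \<partial>lborel)
          / (\<integral>\<^sup>+x. ennreal ((u x)\<^sup>2) \<partial>lborel)"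
      unfolding lambda1_def nn_integral_completion by (intro INF_lower) auto
    also have "(\<integral>\<^sup>+y. (\<integral>\<^sup>+x. ennreal ((\<psi> (y - a x) + \<psi> (x - a y)) * (u x - u y)\<^sup>2) \<partial>lborel) \<partial>lborel)
        = 2 * (\<integral>\<^sup>+z. ennreal (\<psi>' z) * (\<integral>\<^sup>+x. ennreal ((u x - u (a x + z))\<^sup>2) \<partial>lborel) \<partial>lborel)"
      unfolding nonlocal_energy_cong_AE[OF a \<psi>'] by (rule nonlocal_energy_eq) (auto intro: \<psi>'_nonneg)
    also have "\<dots> \<le> 2 * (\<integral>\<^sup>+z. ennreal (\<psi>' z) * (ennreal c * (F + ennreal e)) \<partial>lborel)"
    \<comment> \<open>The comparison is only almost everywhere in \<open>z\<close>, because
      \<open>\<psi>'\<close> is known to vanish off the ball only where it agrees with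
      \<open>\<psi>\<close>.\<close>
    proof (intro mult_left_mono nn_integral_mono_AE)
      show "AE z in lborel. ennreal (\<psi>' z) * (\<integral>\<^sup>+x. ennreal ((u x - u (a x + z))\<^sup>2) \<partial>lborel)
          \<le> ennreal (\<psi>' z) * (ennreal c * (F + ennreal e))"
        using \<psi>'
      proof eventually_elim
        case (elim z)
        show ?case
        proof (cases "norm z \<le> 1")
          case True
          have "(\<integral>\<^sup>+x. ennreal ((u x - u (a x + z))\<^sup>2) \<partial>lborel)
              = ennreal c * (\<integral>\<^sup>+x. ennreal ((\<phi>' x - \<phi>' (a x + s *\<^sub>R z))\<^sup>2) \<partial>lborel)"
            \<comment> \<open>Linearity gives
              \<open>s *\<^sub>R (a x + z) = a (s *\<^sub>R x) + s *\<^sub>R z\<close>, so the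
              integrand is a function of \<open>s *\<^sub>R x\<close>.\<close>
            using c[of "\<lambda>x. ennreal ((\<phi>' x - \<phi>' (a x + s *\<^sub>R z))\<^sup>2)"]
            by (simp add: u_def linear_scale[OF a(1)] scaleR_add_right)
          also have "norm (s *\<^sub>R z) < d"
            using \<open>s > 0\<close> \<open>s < d\<close> by (auto intro: le_less_trans[OF mult_left_le[OF True]])
          then have "ennreal c * (\<integral>\<^sup>+x. ennreal ((\<phi>' x - \<phi>' (a x + s *\<^sub>R z))\<^sup>2) \<partial>lborel)
              \<le> ennreal c * (F + ennreal e)"
            by (intro mult_left_mono d) auto
          finally show ?thesis
            by (intro mult_left_mono) auto
        next
          case False
          then show ?thesis
            using elim supp[of z] by simp
        qed
      qed
    qed auto
    also have "\<dots> = 2 * J * (F + ennreal e) * ennreal c"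
      by (subst nn_integral_multc) (auto simp: J_def mult_ac)
    finally have "lambda1 (\<lambda>x y. \<psi> (y - a x) + \<psi> (x - a y)) \<le> 2 * J * (F + ennreal e) * ennreal c / ennreal c"
      by (simp add: u2 divide_right_mono_ennreal)
    then show ?thesis
      using \<open>c > 0\<close> by (simp add: ennreal_mult_divide_eq)
  qed
  have "lambda1 (\<lambda>x y. \<psi> (y - a x) + \<psi> (x - a y)) \<le> 2 * J * F"
  proof (rule ennreal_le_epsilon)
    fix e :: real assume "e > 0"
    obtain j where j: "J = ennreal j" "j \<ge> 0"
      using fin J by (cases J) auto
    \<comment> \<open>This makes \<open>2 * j * t \<le> e\<close>, also when
      \<open>j = 0\<close>.\<close>
    define t where "t = e / (2 * j + 1)"
    have "t > 0"
      using j \<open>e > 0\<close> by (simp add: t_def)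
    have "2 * J * ennreal t = ennreal (2 * j * t)"
      using j \<open>t > 0\<close> by (simp add: ennreal_mult)
    also have "\<dots> \<le> ennreal e"
      using j \<open>e > 0\<close> by (intro ennreal_leI) (simp add: t_def field_simps)
    finally have "2 * J * F + 2 * J * ennreal t \<le> 2 * J * F + ennreal e"
      by (rule add_left_mono)
    then show "lambda1 (\<lambda>x y. \<psi> (y - a x) + \<psi> (x - a y)) \<le> 2 * J * F + ennreal e"
      using le[OF \<open>t > 0\<close>] unfolding distrib_left by (rule order_trans[rotated])
  qed
  then show ?thesis
    by (simp add: F J)
qed

theorem theorem1p3:
  fixes \<psi> :: "real ^ 'd \<Rightarrow> real"
    and a :: "real ^ 'd \<Rightarrow> real ^ 'd"
    and K :: "real ^ 'd \<Rightarrow> real ^ 'd \<Rightarrow> real"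
  assumes "\<And>x. \<psi> x \<ge> 0"
    and "bounded (range \<psi>)"
    and "\<psi> \<in> borel_measurable lebesgue"
    and "\<And>x. x \<notin> cball 0 1 \<Longrightarrow> \<psi> x = 0"
    and "diffeomorphism a"
    and "\<And>R x. R > 0 \<Longrightarrow> a (R *\<^sub>R x) = R *\<^sub>R a x"
    and "\<And>x y. K x y = \<psi> (y - a x) + \<psi> (x - a y)"
  shows "lambda1 K \<le>
    2 * (\<integral>\<^sup>+x. ennreal (\<psi> x) \<partial>lebesgue) *
      (INF \<phi> \<in> admissible. \<integral>\<^sup>+x. ennreal ((\<phi> x - \<phi> (a x))\<^sup>2) \<partial>lebesgue)"
proof -
  have "bij a"
    using assms(5) by (simp add: diffeomorphism_def)
  obtain D where D: "(a has_derivative D) (at 0)"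
    using assms(5) by (auto simp: diffeomorphism_def C1_map_def)
  then have "linear a"
    using has_derivative_homogeneous_imp_eq[OF D assms(6)] has_derivative_linear by blast
  have K: "K = (\<lambda>x y. \<psi> (y - a x) + \<psi> (x - a y))"
    using assms(7) by blast
  obtain b where b: "\<And>x. \<psi> x \<le> b"
    using assms(2) by (auto simp: bounded_iff abs_le_iff)
  \<comment> \<open>Boundedness and the support in a ball make the integral finite, which both
    \<open>lambda1_le_admissible\<close> and \<open>mult_INF_ennreal\<close> rely on.\<close>
  have "(\<integral>\<^sup>+x. ennreal (\<psi> x) \<partial>lebesgue) \<le> (\<integral>\<^sup>+x. ennreal b * indicator (cball 0 1 :: (real ^ 'd) set) x \<partial>lborel)"
    unfolding nn_integral_completion
    by (intro nn_integral_mono) (use assms(4) b in \<open>auto simp: indicator_def intro!: ennreal_leI\<close>)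
  also have "\<dots> < \<infinity>"
    using emeasure_bounded_finite[OF bounded_cball, of "0 :: real ^ 'd" 1]
    by (simp add: nn_integral_cmult_indicator ennreal_mult_less_top)
  finally have fin: "(\<integral>\<^sup>+x. ennreal (\<psi> x) \<partial>lebesgue) < \<infinity>" .
  then have "2 * (\<integral>\<^sup>+x. ennreal (\<psi> x) \<partial>lebesgue) < \<infinity>"
    by (simp add: ennreal_mult_less_top)
  then show ?thesis
    unfolding K using lambda1_le_admissible[OF \<open>linear a\<close> \<open>bij a\<close> assms(1,3,4) fin]
    by (simp add: mult_INF_ennreal admissible_nonempty INF_greatest)
qed

end
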